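(* For every integer $n\geq 2$, $\Gamma_b(P_n)=I\!R_b(P_n)=\operatorname{diam}(P_n)=n-1$, where $P_n$ is the path of order $n$.
   Context: All graphs are finite, simple and connected; $d_G(u,v)$ is the distance, $e_G(v)$ the eccentricity of $v$, $\operatorname{diam}(G)$ the diameter. A broadcast on $G=(V,E)$ is a function $f:V\to\{0,\dots,\operatorname{diam}(G)\}$ with $f(v)\le e_G(v)$ for all $v$. Let $V^+_f=\{v: f(v)>0\}$. A vertex $u$ hears $v$ (and $v$ $f$-dominates $u$) if $v\in V^+_f$ and $d_G(u,v)\le f(v)$. Let $H_f(u)=\{v\in V^+_f: d_G(u,v)\le f(v)\}$. For $v\in V^+_f$, $PN_f(v)=\{u\in V: H_f(u)=\{v\}\}$, and the private border $PB_f(v)$ is $\{v\}$ if $f(v)=1$ and $PN_f(v)=\{v\}$, and otherwise $PB_f(v)=\{u\in PN_f(v): d_G(u,v)=f(v)\}$. The cost of $f$ is $\sigma(f)=\sum_{v\in V}f(v)$. A broadcast of some type is minimal if no other broadcast $g\ne f$ of the same type satisfies $g(u)\le f(u)$ for all $u$. A broadcast $f$ is dominating if $|H_f(u)|\ge 1$ for every $u\in V$; $\Gamma_b(G)$ is the maximum cost of a minimal dominating broadcast on $G$. A broadcast $f$ is irredundant if $PB_f(v)\neq\emptyset$ for every $v\in V^+_f$; $I\!R_b(G)$ is the maximum cost of an irredundant broadcast on $G$. *)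

theory Defs
  imports Main "HOL-Library.FuncSet"
begin

record 'a graph =
  verts :: "'a set"
  edges :: "'a set set"

definition arcs :: "'a graph \<Rightarrow> ('a \<times> 'a) set" where
  "arcs G = {(u, v). u \<in> verts G \<and> v \<in> verts G \<and> {u, v} \<in> edges G}"

definition fin_simple_connected_graph :: "'a graph \<Rightarrow> bool" where
  "fin_simple_connected_graph G \<longleftrightarrow>
     finite (verts G) \<and> verts G \<noteq> {} \<and>
     (\<forall>e \<in> edges G. e \<subseteq> verts G \<and> card e = 2) \<and>
     (\<forall>u \<in> verts G. \<forall>v \<in> verts G. (u, v) \<in> (arcs G)\<^sup>*)"

text \<open>A pair lies in the \<open>k\<close>-th relational power of \<open>arcs G\<close> iff its components are joined
  by a walk with \<open>k\<close> edges.  Distance, eccentricity and diameter are meaningful only for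
  graphs satisfying \<open>fin_simple_connected_graph\<close>.\<close>

definition gdist :: "'a graph \<Rightarrow> 'a \<Rightarrow> 'a \<Rightarrow> nat" where
  "gdist G u v = (LEAST k. (u, v) \<in> arcs G ^^ k)"

definition ecc :: "'a graph \<Rightarrow> 'a \<Rightarrow> nat" where
  "ecc G v = Max (gdist G v ` verts G)"

definition diam :: "'a graph \<Rightarrow> nat" where
  "diam G = Max (ecc G ` verts G)"

text \<open>Broadcasts are extensional functions on the vertex set, so that equality of broadcasts
  (used in minimality) is equality on the vertices.\<close>

definition broadcast :: "'a graph \<Rightarrow> ('a \<Rightarrow> nat) \<Rightarrow> bool" where
  "broadcast G f \<longleftrightarrow> f \<in> verts G \<rightarrow>\<^sub>E {0..diam G} \<and> (\<forall>v \<in> verts G. f v \<le> ecc G v)"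

definition cost :: "'a graph \<Rightarrow> ('a \<Rightarrow> nat) \<Rightarrow> nat" where
  "cost G f = (\<Sum>v \<in> verts G. f v)"

definition Vplus :: "'a graph \<Rightarrow> ('a \<Rightarrow> nat) \<Rightarrow> 'a set" where
  "Vplus G f = {v \<in> verts G. f v > 0}"

definition hears :: "'a graph \<Rightarrow> ('a \<Rightarrow> nat) \<Rightarrow> 'a \<Rightarrow> 'a set" where
  "hears G f u = {v \<in> Vplus G f. gdist G u v \<le> f v}"

definition priv_nbhd :: "'a graph \<Rightarrow> ('a \<Rightarrow> nat) \<Rightarrow> 'a \<Rightarrow> 'a set" where
  "priv_nbhd G f v = {u \<in> verts G. hears G f u = {v}}"

definition priv_border :: "'a graph \<Rightarrow> ('a \<Rightarrow> nat) \<Rightarrow> 'a \<Rightarrow> 'a set" where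
  "priv_border G f v =
     (if f v = 1 \<and> priv_nbhd G f v = {v} then {v}
      else {u \<in> priv_nbhd G f v. gdist G u v = f v})"

definition dominating_broadcast :: "'a graph \<Rightarrow> ('a \<Rightarrow> nat) \<Rightarrow> bool" where
  "dominating_broadcast G f \<longleftrightarrow>
     broadcast G f \<and> (\<forall>u \<in> verts G. card (hears G f u) \<ge> 1)"

definition irredundant_broadcast :: "'a graph \<Rightarrow> ('a \<Rightarrow> nat) \<Rightarrow> bool" where
  "irredundant_broadcast G f \<longleftrightarrow>
     broadcast G f \<and> (\<forall>v \<in> Vplus G f. priv_border G f v \<noteq> {})"

definition minimal_of_type ::
  "('a graph \<Rightarrow> ('a \<Rightarrow> nat) \<Rightarrow> bool) \<Rightarrow> 'a graph \<Rightarrow> ('a \<Rightarrow> nat) \<Rightarrow> bool" where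
  "minimal_of_type T G f \<longleftrightarrow>
     T G f \<and> \<not> (\<exists>g. T G g \<and> g \<noteq> f \<and> (\<forall>u \<in> verts G. g u \<le> f u))"

definition Gamma_b :: "'a graph \<Rightarrow> nat" where
  "Gamma_b G = Max (cost G ` {f. minimal_of_type dominating_broadcast G f})"

definition IR_b :: "'a graph \<Rightarrow> nat" where
  "IR_b G = Max (cost G ` {f. irredundant_broadcast G f})"

definition path_graph :: "nat \<Rightarrow> nat graph" where
  "path_graph n = \<lparr>verts = {0..<n}, edges = {{i, Suc i} | i. Suc i < n}\<rparr>"

lemma path_graph_fin_simple_connected:
  assumes "n \<ge> 1"
  shows "fin_simple_connected_graph (path_graph n)"
proof -
  let ?A = "arcs (path_graph n)"
  have step: "(i, Suc i) \<in> ?A" "(Suc i, i) \<in> ?A" if "Suc i < n" for i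
    using that by (auto simp: arcs_def path_graph_def)
  have from0: "i < n \<Longrightarrow> (0, i) \<in> ?A\<^sup>*" for i
    by (induction i) (auto intro: rtrancl_into_rtrancl step)
  have to0: "i < n \<Longrightarrow> (i, 0) \<in> ?A\<^sup>*" for i
    by (induction i) (auto intro: converse_rtrancl_into_rtrancl step)
  have "(u, v) \<in> ?A\<^sup>*" if "u < n" "v < n" for u v
    using to0[OF that(1)] from0[OF that(2)] by (rule rtrancl_trans)
  then show ?thesis
    using assms by (auto simp: fin_simple_connected_graph_def path_graph_def)
qed

end

theory Submission imports Defs begin

text \<open>
  Lowering a minimal dominating broadcast by one at a broadcasting vertex leaves some vertex
  undominated, and that vertex lies in the private border; so minimal dominating broadcasts are
  irredundant, and it suffices to bound the cost of irredundant ones.  Choose a private border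
  vertex \<open>p v\<close> for every broadcasting \<open>v\<close>.  The geodesics from \<open>v\<close> to \<open>p v\<close> are pairwise disjoint:
  if \<open>x\<close> lies on those of \<open>v\<close> and \<open>w\<close>, then
  \<open>f w < d (p v) w \<le> d (p v) x + d x w\<close> and \<open>f v < d (p w) v \<le> d (p w) x + d x v\<close>, and adding up gives
  \<open>f v + f w < d v (p v) + d w (p w) \<le> f v + f w\<close>.  A geodesic has \<open>f v + 1\<close> vertices, or just one
  in the exceptional case \<open>f v = 1\<close>, \<open>p v = v\<close>.  Hence the cost is at most \<open>n\<close>, and cost \<open>n\<close> would
  force \<open>f = 1\<close> everywhere, which is not irredundant.  The value \<open>n - 1\<close> is attained by
  broadcasting from an end of the path only.
\<close>

section \<open>Minimal dominating broadcasts on arbitrary graphs\<close>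

text \<open>Connectedness provides a walk, so the \<open>LEAST\<close> defining the distance is
  attained, and a walk of length 0 has equal ends.\<close>

lemma gdist_eq_0_iff:
  assumes "fin_simple_connected_graph G" "u \<in> verts G" "v \<in> verts G"
  shows "gdist G u v = 0 \<longleftrightarrow> u = v"
proof -
  have "(u, v) \<in> (arcs G)\<^sup>*"
    using assms by (simp add: fin_simple_connected_graph_def)
  then obtain k where "(u, v) \<in> arcs G ^^ k"
    using rtrancl_imp_relpow by blast
  then have "(u, v) \<in> arcs G ^^ gdist G u v"
    unfolding gdist_def by (rule LeastI)
  then show ?thesis
    by (auto simp: gdist_def)
qed

text \<open>This makes the sets of costs finite, so that \<open>Max\<close> in
  \<open>Gamma_b\<close> and \<open>IR_b\<close> is a genuine maximum.\<close>

lemma finite_broadcasts: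
  assumes "finite (verts G)"
  shows "finite {f. broadcast G f}"
  by (rule finite_subset[of _ "verts G \<rightarrow>\<^sub>E {0..diam G}"])
     (use assms in \<open>auto simp: broadcast_def intro: finite_PiE\<close>)

lemma finite_hears:
  assumes "finite (verts G)"
  shows "finite (hears G f u)"
  using assms by (simp add: hears_def Vplus_def)

lemma dominating_broadcast_iff:
  assumes "finite (verts G)"
  shows "dominating_broadcast G f \<longleftrightarrow> broadcast G f \<and> (\<forall>u \<in> verts G. hears G f u \<noteq> {})"
  using finite_hears[OF assms, of f]
  by (auto simp: dominating_broadcast_def Suc_le_eq card_gt_0_iff)

lemma minimal_dominating_imp_irredundant:
  assumes G: "fin_simple_connected_graph G"
    and min: "minimal_of_type dominating_broadcast G f"
  shows "irredundant_broadcast G f"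
proof -
  have fin: "finite (verts G)"
    using G by (simp add: fin_simple_connected_graph_def)
  have bf: "broadcast G f" and dom: "\<And>u. u \<in> verts G \<Longrightarrow> hears G f u \<noteq> {}"
    using min by (auto simp: minimal_of_type_def dominating_broadcast_iff[OF fin])
  have "priv_border G f v \<noteq> {}" if v: "v \<in> Vplus G f" for v
  proof -
    define g where "g = f(v := f v - 1)"
    have vG: "v \<in> verts G" and fv: "f v > 0"
      using v by (auto simp: Vplus_def)
    have bg: "broadcast G g"
    proof -
      have "g \<in> verts G \<rightarrow>\<^sub>E {0..diam G}"
        using bf vG unfolding g_def broadcast_def by (fastforce simp: PiE_iff extensional_def)
      moreover have "\<forall>w \<in> verts G. g w \<le> ecc G w"
        using bf unfolding broadcast_def g_def by (metis diff_le_self fun_upd_apply le_trans)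
      ultimately show ?thesis by (simp add: broadcast_def)
    qed
    have "g v \<noteq> f v" and "\<forall>u \<in> verts G. g u \<le> f u"
      using fv by (auto simp: g_def)
    then have "\<not> dominating_broadcast G g"
      using min unfolding minimal_of_type_def by metis
    then obtain u where u: "u \<in> verts G" "hears G g u = {}"
      using bg by (auto simp: dominating_broadcast_iff[OF fin])
    \<comment> \<open>\<open>g\<close> differs from \<open>f\<close> only at \<open>v\<close>, so
      \<open>u\<close>, hearing nobody under \<open>g\<close>, can hear only \<open>v\<close> under
      \<open>f\<close>.\<close>
    have "w = v" if "w \<in> hears G f u" for w
      using that u(2) by (auto simp: hears_def Vplus_def g_def split: if_splits)
    with dom[OF u(1)] have hu: "hears G f u = {v}"
      by blast
    then have upn: "u \<in> priv_nbhd G f v"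
      using u by (simp add: priv_nbhd_def)
    have le: "gdist G x v \<le> f v" if "x \<in> priv_nbhd G f v" for x
      using that by (auto simp: priv_nbhd_def hears_def)
    show ?thesis
    \<comment> \<open>If \<open>f v = 1\<close>, then \<open>v\<close> no longer broadcasts under
      \<open>g\<close> and \<open>u\<close> may be \<open>v\<close> itself; the exceptional clause
      of \<open>priv_border\<close> covers this.\<close>
    proof (cases "f v = 1")
      case True
      show ?thesis
      proof (cases "priv_nbhd G f v = {v}")
        case False
        then obtain x where x: "x \<in> priv_nbhd G f v" "x \<noteq> v"
          using upn by blast
        then have "gdist G x v \<noteq> 0"
          using gdist_eq_0_iff[OF G _ vG] by (auto simp: priv_nbhd_def)
        with le[OF x(1)] True have "gdist G x v = f v"
          by simp
        with x(1) False show ?thesis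
          by (auto simp: priv_border_def)
      qed (use True in \<open>simp add: priv_border_def\<close>)
    next
      case False
      \<comment> \<open>Now \<open>v\<close> still broadcasts under \<open>g\<close>, so
        \<open>u\<close> lies beyond distance \<open>f v - 1\<close>.\<close>
      with fv vG have "v \<in> Vplus G g"
        by (simp add: Vplus_def g_def)
      with u(2) have "\<not> gdist G u v \<le> f v - 1"
        by (auto simp: hears_def g_def)
      with le[OF upn] have "gdist G u v = f v"
        by simp
      with False upn show ?thesis
        by (auto simp: priv_border_def)
    qed
  qed
  with bf show ?thesis
    by (simp add: irredundant_broadcast_def)
qed

section \<open>Distances in paths\<close>

lemma verts_path_graph [simp]: "verts (path_graph n) = {0..<n}"
  by (simp add: path_graph_def)

text \<open>With truncated subtraction, \<open>(u - v) + (v - u)\<close> is the absolute difference of \<open>u\<close> and \<open>v\<close>.\<close>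

lemma walk_path_graph_ge:
  assumes "(u, v) \<in> arcs (path_graph n) ^^ k"
  shows "(u - v) + (v - u) \<le> k"
  using assms
proof (induction k arbitrary: v)
  case (Suc k)
  then obtain w where "(u - w) + (w - u) \<le> k" "(w, v) \<in> arcs (path_graph n)"
    by auto
  then show ?case
    by (auto simp: arcs_def path_graph_def doubleton_eq_iff)
qed simp

lemma walk_path_graph_exists:
  assumes "u + k < n"
  shows "(u, u + k) \<in> arcs (path_graph n) ^^ k" "(u + k, u) \<in> arcs (path_graph n) ^^ k"
proof -
  have step: "(i, Suc i) \<in> arcs (path_graph n)" "(Suc i, i) \<in> arcs (path_graph n)"
    if "Suc i < n" for i
    using that by (auto simp: arcs_def path_graph_def)
  show "(u, u + k) \<in> arcs (path_graph n) ^^ k"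
    using assms by (induction k) (auto intro: step)
  show "(u + k, u) \<in> arcs (path_graph n) ^^ k"
    using assms
  \<comment> \<open>The start of the walk moves with \<open>k\<close>, so the new edge goes in front
    instead of at the end.\<close>
  proof (induction k)
    case (Suc k)
    then show ?case
      using relpow_Suc_I2[OF step(2)[of "u + k"]] by simp
  qed simp
qed

lemma gdist_path_graph:
  assumes "u < n" "v < n"
  shows "gdist (path_graph n) u v = (u - v) + (v - u)"
  unfolding gdist_def
proof (rule Least_equality)
  show "(u, v) \<in> arcs (path_graph n) ^^ ((u - v) + (v - u))"
    using walk_path_graph_exists[of u "v - u" n] walk_path_graph_exists[of v "u - v" n] assms
    by (cases "u \<le> v") auto
qed (rule walk_path_graph_ge)

lemma ecc_path_graph_le:
  assumes "v < n"
  shows "ecc (path_graph n) v \<le> n - 1"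
  using assms by (auto simp: ecc_def gdist_path_graph)

lemma ecc_path_graph_0:
  assumes "n \<ge> 1"
  shows "ecc (path_graph n) 0 = n - 1"
proof (rule antisym)
  have "gdist (path_graph n) 0 (n - 1) \<le> ecc (path_graph n) 0"
    unfolding ecc_def using assms by (intro Max_ge) auto
  then show "n - 1 \<le> ecc (path_graph n) 0"
    using assms by (simp add: gdist_path_graph)
qed (use assms ecc_path_graph_le in auto)

lemma diam_path_graph:
  assumes "n \<ge> 1"
  shows "diam (path_graph n) = n - 1"
  unfolding diam_def
proof (rule Max_eqI)
  show "n - 1 \<in> ecc (path_graph n) ` verts (path_graph n)"
    using assms ecc_path_graph_0[OF assms] by (intro image_eqI[of _ _ 0]) auto
qed (use ecc_path_graph_le in auto)

section \<open>Upper bound for irredundant broadcasts\<close>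

lemma cost_irredundant_path_graph_le:
  assumes n: "n \<ge> 2" and irr: "irredundant_broadcast (path_graph n) f"
  shows "cost (path_graph n) f \<le> n - 1"
proof (rule ccontr)
  assume "\<not> cost (path_graph n) f \<le> n - 1"
  then have ge: "n \<le> cost (path_graph n) f"
    by simp
  let ?G = "path_graph n"
  let ?V = "Vplus ?G f"
  define p where "p v = (SOME u. u \<in> priv_border ?G f v)" for v
  \<comment> \<open>On a path, the geodesic from \<open>v\<close> to \<open>p v\<close> is this
    interval.\<close>
  define I where "I v = {min v (p v)..max v (p v)}" for v
  have Vn: "v < n" "f v > 0" if "v \<in> ?V" for v
    using that by (auto simp: Vplus_def)
  have fin: "finite ?V"
    by (simp add: Vplus_def)
  have pb: "p v \<in> priv_border ?G f v" if "v \<in> ?V" for v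
    using irr that unfolding p_def irredundant_broadcast_def by (simp add: some_in_eq)
  have p: "p v < n" "hears ?G f (p v) = {v}" if "v \<in> ?V" for v
    using pb[OF that] by (auto simp: priv_border_def priv_nbhd_def split: if_splits)
  have type: "(p v - v) + (v - p v) = f v \<or> f v = 1 \<and> p v = v \<and> priv_nbhd ?G f v = {v}"
    if "v \<in> ?V" for v
    using pb[OF that] p(1)[OF that] Vn[OF that]
    by (auto simp: priv_border_def gdist_path_graph split: if_splits)
  have far: "f w < (p v - w) + (w - p v)" if "v \<in> ?V" "w \<in> ?V" "v \<noteq> w" for v w
  proof -
    have "w \<notin> hears ?G f (p v)"
      using p(2)[OF that(1)] that(3) by simp
    then show ?thesis
      using that(2) p(1)[OF that(1)] Vn(1)[OF that(2)] by (auto simp: hears_def gdist_path_graph)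
  qed
  have disj: "I v \<inter> I w = {}" if "v \<in> ?V" "w \<in> ?V" "v \<noteq> w" for v w
  proof (rule ccontr)
    assume "I v \<inter> I w \<noteq> {}"
    then obtain x where x: "x \<in> I v" "x \<in> I w"
      by blast
    define d :: "nat \<Rightarrow> nat \<Rightarrow> nat" where "d a b = (a - b) + (b - a)" for a b
    have tri: "d a c \<le> d a b + d b c" for a b c
      by (auto simp: d_def)
    have between: "d (p u) x + d x u = d (p u) u" if "x \<in> I u" for u
      using that by (cases "u \<le> p u") (auto simp: d_def I_def)
    have "d (p v) v \<le> f v" "d (p w) w \<le> f w"
      using type[OF that(1)] type[OF that(2)] by (auto simp: d_def)
    moreover have "f w < d (p v) w" "f v < d (p w) v"
      using far[OF that] far[OF that(2,1) not_sym[OF that(3)]] by (simp_all add: d_def)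
    ultimately show False
      using between[OF x(1)] between[OF x(2)] tri[of "p v" w x] tri[of "p w" v x] by linarith
  qed
  have card_I: "card (I v) = (p v - v) + (v - p v) + 1" for v
    by (auto simp: I_def min_def max_def)
  have le: "f v \<le> card (I v)" if "v \<in> ?V" for v
    using type[OF that] by (auto simp: card_I)
  have cost_eq: "cost ?G f = (\<Sum>v\<in>?V. f v)"
    unfolding cost_def by (rule sum.mono_neutral_right) (auto simp: Vplus_def)
  have card_U: "card (\<Union>v\<in>?V. I v) = (\<Sum>v\<in>?V. card (I v))"
  proof (rule card_UN_disjoint[OF fin])
    show "\<forall>v\<in>?V. finite (I v)"
      by (simp add: I_def)
    show "\<forall>v\<in>?V. \<forall>w\<in>?V. v \<noteq> w \<longrightarrow> I v \<inter> I w = {}"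
      using disj by blast
  qed
  have U_sub: "(\<Union>v\<in>?V. I v) \<subseteq> {0..<n}"
  proof (rule UN_least)
    fix v assume "v \<in> ?V"
    from p(1)[OF this] Vn(1)[OF this] show "I v \<subseteq> {0..<n}"
      by (auto simp: I_def)
  qed
  then have "card (\<Union>v\<in>?V. I v) \<le> n"
    using card_mono[OF _ U_sub] by simp
  \<comment> \<open>The chain \<open>n\<close> \<le> cost \<le> size of the disjoint union \<le>
    \<open>n\<close> collapses to equalities.\<close>
  then have sum_eq: "(\<Sum>v\<in>?V. f v) = (\<Sum>v\<in>?V. card (I v))" and "card (\<Union>v\<in>?V. I v) = n"
    using ge sum_mono[of ?V f "\<lambda>v. card (I v)", OF le] by (auto simp: cost_eq card_U)
  then have U: "(\<Union>v\<in>?V. I v) = {0..<n}"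
    using U_sub by (intro card_subset_eq) auto
  have single: "f v = 1 \<and> p v = v" if "v \<in> ?V" for v
  proof -
    \<comment> \<open>Equal sums of termwise ordered summands agree termwise; this excludes
      full-length geodesics, which have \<open>f v + 1\<close> vertices.\<close>
    have "f v = card (I v)"
      using sum_eq le that fin by (rule sum_mono_inv)
    then show ?thesis
      using type[OF that] by (auto simp: card_I)
  qed
  then have "(\<Union>v\<in>?V. I v) = ?V"
    by (auto simp: I_def)
  \<comment> \<open>Since \<open>f 1 = 1\<close>, vertex 0 hears 1, yet \<open>p 0 = 0\<close> must
    hear only 0.\<close>
  with U n have "0 \<in> ?V" "1 \<in> ?V"
    by auto
  then show False
    using far[of 0 1] single[of 0] single[of 1] by auto
qed

section \<open>A broadcast attaining the bound\<close>

text \<open>The restricted lambda makes the function extensional, as \<open>broadcast\<close>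
  demands.\<close>

definition end_broadcast :: "nat \<Rightarrow> nat \<Rightarrow> nat" where
  "end_broadcast n = (\<lambda>v\<in>{0..<n}. if v = 0 then n - 1 else 0)"

lemma cost_end_broadcast:
  assumes "n \<ge> 1"
  shows "cost (path_graph n) (end_broadcast n) = n - 1"
  using assms by (simp add: cost_def end_broadcast_def)

text \<open>A dominating broadcast below this one vanishes off 0, so the far end
  \<open>n - 1\<close> can hear only 0, which forces the value \<open>n - 1\<close> there.\<close>

lemma minimal_dominating_end_broadcast:
  assumes n: "n \<ge> 2"
  shows "minimal_of_type dominating_broadcast (path_graph n) (end_broadcast n)"
proof -
  let ?G = "path_graph n"
  let ?f = "end_broadcast n"
  have fin: "finite (verts ?G)"
    by simp
  have "broadcast ?G ?f"
    using n by (auto simp: broadcast_def end_broadcast_def diam_path_graph ecc_path_graph_0)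
  moreover have "0 \<in> hears ?G ?f u" if "u < n" for u
    using that n by (auto simp: hears_def Vplus_def end_broadcast_def gdist_path_graph)
  ultimately have "dominating_broadcast ?G ?f"
    by (force simp: dominating_broadcast_iff[OF fin])
  moreover have "g = ?f" if g: "dominating_broadcast ?G g" "\<forall>u \<in> verts ?G. g u \<le> ?f u" for g
  proof -
    have zero: "g v = 0" if "v < n" "v \<noteq> 0" for v
      using g(2)[rule_format, of v] that by (simp add: end_broadcast_def)
    obtain v where "v \<in> hears ?G g (n - 1)"
      using g(1) n by (fastforce simp: dominating_broadcast_iff[OF fin])
    then have v: "v < n" "g v > 0" "gdist ?G (n - 1) v \<le> g v"
      by (auto simp: hears_def Vplus_def)
    with zero have "v = 0"
      by (metis less_irrefl)
    with v n have "n - 1 \<le> g 0"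
      by (simp add: gdist_path_graph)
    moreover have "g 0 \<le> n - 1"
      using g(2)[rule_format, of 0] n by (simp add: end_broadcast_def)
    moreover have "g \<in> extensional {0..<n}"
      using g(1) by (auto simp: dominating_broadcast_def broadcast_def PiE_iff)
    ultimately show ?thesis
      using zero by (intro extensionalityI[of _ "{0..<n}"]) (auto simp: end_broadcast_def)
  qed
  ultimately show ?thesis
    unfolding minimal_of_type_def by blast
qed

theorem theorem3p1:
  fixes n :: nat
  assumes "n \<ge> 2"
  shows "Gamma_b (path_graph n) = IR_b (path_graph n) \<and>
         IR_b (path_graph n) = diam (path_graph n) \<and>
         diam (path_graph n) = n - 1"
proof -
  let ?G = "path_graph n"
  have n1: "n \<ge> 1"
    using assms by simp
  have irr: "irredundant_broadcast ?G f" if "minimal_of_type dominating_broadcast ?G f" for f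
    using minimal_dominating_imp_irredundant path_graph_fin_simple_connected[OF n1] that .
  have fin: "finite {f. broadcast ?G f}"
    by (rule finite_broadcasts) simp
  have "Gamma_b ?G = n - 1"
    unfolding Gamma_b_def
  proof (rule Max_eqI)
    show "finite (cost ?G ` {f. minimal_of_type dominating_broadcast ?G f})"
      by (intro finite_imageI finite_subset[OF _ fin])
         (auto simp: minimal_of_type_def dominating_broadcast_def)
    show "n - 1 \<in> cost ?G ` {f. minimal_of_type dominating_broadcast ?G f}"
      using minimal_dominating_end_broadcast[OF assms] cost_end_broadcast[OF n1] by force
  qed (use cost_irredundant_path_graph_le[OF assms] irr in auto)
  moreover have "IR_b ?G = n - 1"
    unfolding IR_b_def
  proof (rule Max_eqI)
    show "finite (cost ?G ` {f. irredundant_broadcast ?G f})"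
      by (intro finite_imageI finite_subset[OF _ fin]) (auto simp: irredundant_broadcast_def)
    show "n - 1 \<in> cost ?G ` {f. irredundant_broadcast ?G f}"
      using irr[OF minimal_dominating_end_broadcast[OF assms]] cost_end_broadcast[OF n1] by force
  qed (use cost_irredundant_path_graph_le[OF assms] in auto)
  ultimately show ?thesis
    using diam_path_graph[OF n1] by simp
qed

end
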